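(* Let $\mathscr{W}$ be a model class with loss function $\ell$, and let $Z_1,Z_2,\ldots,Z_n$ be i.i.d. samples from a distribution $p$ on $\mathscr{Z}$, such that for some $\sigma>0$ the random variable $\ell(Z,w)$, $Z\sim p$, is $\sigma^2$-subgaussian for every $w\in\mathscr{W}$. Then $$\mathsf{E}(\Delta_n(\mathscr{W}))\le 2\,\mathsf{R}_n(\mathscr{W}),$$ where $\Delta_n(\mathscr{W})=\sup_{w\in\mathscr{W}}|L(w)-L_n(w)|$ is the worst-case generalization error and $\mathsf{R}_n(\mathscr{W})$ is the Rademacher complexity.
   Context: Learning setup: $\mathscr{Z}$ is a data space, $\mathscr{W}$ a nonempty model class, $\ell:\mathscr{Z}\times\mathscr{W}\to[0,\infty)$ a loss function, $p$ a probability distribution on $\mathscr{Z}$, $Z,Z_1,\ldots,Z_n$ i.i.d. from $p$. The risk is $L(w)=\mathsf{E}(\ell(Z,w))$ and the empirical risk is $L_n(w)=\frac1n\sum_{i=1}^n\ell(Z_i,w)$. A random variable $X$ with finite mean is $\sigma^2$-subgaussian if $\mathsf{E}(e^{\lambda(X-\mathsf{E}X)})\le e^{\lambda^2\sigma^2/2}$ for all $\lambda\in\mathbb{R}$. Rademacher complexity: let $\varepsilon_1,\ldots,\varepsilon_n$ be i.i.d., uniform on $\{-1,1\}$, independent of $Z_1,\ldots,Z_n$. Then $$\mathsf{R}_n(\mathscr{W})=\mathsf{E}\Big(\sup_{w\in\mathscr{W}}\Big|\frac1n\sum_{i=1}^n\varepsilon_i\ell(Z_i,w)\Big|\Big),$$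 the expectation being over both $\varepsilon^n$ and $Z^n$. Suprema over $\mathscr{W}$ are assumed measurable. *)

theory Defs
  imports "HOL-Probability.Probability"
begin

text \<open>
  Data are drawn from a probability measure p on 'z; the model class is a set W :: 'w set and
  the loss is l :: 'z => 'w => real.  A sample of size n is a function z :: nat => 'z of which
  only the entries z 1, ..., z n matter.  Suprema over W are taken in ennreal, and their
  expectations are nonnegative (Lebesgue) integrals, so both may be infinite.
\<close>

text \<open>
  The parameter v is the variance proxy, i.e. sigma squared.  Integrability of the exponential
  is required explicitly because the Bochner integral of a non-integrable function is 0.
\<close>

definition subgaussian :: "'a measure \<Rightarrow> ('a \<Rightarrow> real) \<Rightarrow> real \<Rightarrow> bool" where
  "subgaussian M X v \<longleftrightarrow>
     integrable M X \<and>
     (\<forall>t::real. integrable M (\<lambda>x. exp (t * (X x - (\<integral>y. X y \<partial>M)))) \<and>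
        (\<integral>x. exp (t * (X x - (\<integral>y. X y \<partial>M))) \<partial>M) \<le> exp (t\<^sup>2 * v / 2))"

definition risk :: "'z measure \<Rightarrow> ('z \<Rightarrow> 'w \<Rightarrow> real) \<Rightarrow> 'w \<Rightarrow> real" where
  "risk p l w = (\<integral>z. l z w \<partial>p)"

definition empirical_risk :: "('z \<Rightarrow> 'w \<Rightarrow> real) \<Rightarrow> nat \<Rightarrow> (nat \<Rightarrow> 'z) \<Rightarrow> 'w \<Rightarrow> real" where
  "empirical_risk l n z w = (1 / real n) * (\<Sum>i=1..n. l (z i) w)"

definition worst_case_gen_error ::
    "'z measure \<Rightarrow> ('z \<Rightarrow> 'w \<Rightarrow> real) \<Rightarrow> 'w set \<Rightarrow> nat \<Rightarrow> (nat \<Rightarrow> 'z) \<Rightarrow> ennreal" where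
  "worst_case_gen_error p l W n z =
     (SUP w\<in>W. ennreal \<bar>risk p l w - empirical_risk l n z w\<bar>)"

definition rademacher_sup ::
    "('z \<Rightarrow> 'w \<Rightarrow> real) \<Rightarrow> 'w set \<Rightarrow> nat \<Rightarrow> (nat \<Rightarrow> real) \<Rightarrow> (nat \<Rightarrow> 'z) \<Rightarrow> ennreal" where
  "rademacher_sup l W n e z =
     (SUP w\<in>W. ennreal \<bar>(1 / real n) * (\<Sum>i=1..n. e i * l (z i) w)\<bar>)"

text \<open>
  The joint law of n independent uniform signs and an independent i.i.d. sample of size n
  from p.
\<close>

definition sign_sample_measure ::
    "'z measure \<Rightarrow> nat \<Rightarrow> ((nat \<Rightarrow> real) \<times> (nat \<Rightarrow> 'z)) measure" where
  "sign_sample_measure p n =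
     (\<Pi>\<^sub>M i\<in>{1..n}. measure_pmf (pmf_of_set {-1, 1})) \<Otimes>\<^sub>M (\<Pi>\<^sub>M i\<in>{1..n}. p)"

definition rademacher_complexity ::
    "'z measure \<Rightarrow> ('z \<Rightarrow> 'w \<Rightarrow> real) \<Rightarrow> 'w set \<Rightarrow> nat \<Rightarrow> ennreal" where
  "rademacher_complexity p l W n =
     (\<integral>\<^sup>+ (e, z). rademacher_sup l W n e z \<partial>sign_sample_measure p n)"

end

theory Submission
  imports Defs
begin

text \<open>
  Symmetrization with a ghost sample z'.  The usual intermediate quantity, the supremum over W of
  the difference of two empirical risks, need not be measurable.  For a fixed sign vector e it is
  therefore bounded pointwise by the sum of the two Rademacher suprema at the samples obtained
  from z and z' by exchanging the coordinates where e is -1.  This sum is measurable, and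
  the exchange preserves the product law, so twice the expected Rademacher supremum bounds
  the expected error for every e, and the theorem follows by averaging over e.
\<close>

text \<open>The instances for \<open>B\<close> and \<open>- B\<close> are the two halves of the pair
  obtained by exchanging coordinates. They are kept separate because each is later integrated on its
  own. Restriction to \<open>I\<close> puts the result in the extensional function space underlying
  \<open>PiM\<close>.\<close>

definition mix_sample :: "'i set \<Rightarrow> 'i set \<Rightarrow> ('i \<Rightarrow> 'z) \<times> ('i \<Rightarrow> 'z) \<Rightarrow> 'i \<Rightarrow> 'z" where
  "mix_sample I B = (\<lambda>(x, y). \<lambda>i\<in>I. if i \<in> B then x i else y i)"

lemma measurable_mix_sample [measurable]:
  "mix_sample I B \<in> (\<Pi>\<^sub>M i\<in>I. p) \<Otimes>\<^sub>M (\<Pi>\<^sub>M i\<in>I. p) \<rightarrow>\<^sub>M (\<Pi>\<^sub>M i\<in>I. p)"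
  unfolding mix_sample_def split_beta'
  by (rule measurable_restrict) auto

text \<open>Each coordinate of the mixture is drawn from exactly one of two independent samples, so
  it suffices to compare masses of rectangles: at every index one factor contributes
  \<open>A i\<close> and the other the whole space, of mass 1.\<close>

lemma distr_mix_sample:
  assumes "prob_space p" "finite I"
  shows "distr ((\<Pi>\<^sub>M i\<in>I. p) \<Otimes>\<^sub>M (\<Pi>\<^sub>M i\<in>I. p)) (\<Pi>\<^sub>M i\<in>I. p) (mix_sample I B) = (\<Pi>\<^sub>M i\<in>I. p)"
proof -
  interpret prob_space p by fact
  interpret S: product_sigma_finite "\<lambda>_. p" by unfold_locales
  let ?P = "\<Pi>\<^sub>M i\<in>I. p"
  interpret P: prob_space ?P by (rule prob_space_PiM) (rule assms(1))
  show ?thesis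
  proof (rule S.PiM_eqI[OF \<open>finite I\<close>])
    fix A assume A: "\<And>i. i \<in> I \<Longrightarrow> A i \<in> sets p"
    let ?X = "\<Pi>\<^sub>E i\<in>I. if i \<in> B then A i else space p"
    let ?Y = "\<Pi>\<^sub>E i\<in>I. if i \<in> B then space p else A i"
    have AI: "A i \<subseteq> space p" if "i \<in> I" for i
      using A[OF that] by (rule sets.sets_into_space)
    \<comment> \<open>The set \<open>A i\<close> constrains \<open>x\<close> only for
      \<open>i\<close> in \<open>B\<close> and \<open>y\<close> only for \<open>i\<close> outside
      \<open>B\<close>, so the preimage is itself a product of two rectangles.\<close>
    have "mix_sample I B -` Pi\<^sub>E I A \<inter> space (?P \<Otimes>\<^sub>M ?P) = ?X \<times> ?Y"
      using AI by (auto simp: mix_sample_def space_pair_measure space_PiM PiE_iff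
          extensional_def split: if_splits) blast+
    then have "emeasure (distr (?P \<Otimes>\<^sub>M ?P) ?P (mix_sample I B)) (Pi\<^sub>E I A)
        = emeasure (?P \<Otimes>\<^sub>M ?P) (?X \<times> ?Y)"
      using A \<open>finite I\<close> by (subst emeasure_distr) (auto intro!: sets_PiM_I_finite)
    also have "\<dots> = emeasure ?P ?X * emeasure ?P ?Y"
      using A \<open>finite I\<close> by (intro P.emeasure_pair_measure_Times sets_PiM_I_finite) auto
    also have "\<dots> = (\<Prod>i\<in>I. emeasure p (if i \<in> B then A i else space p)) *
        (\<Prod>i\<in>I. emeasure p (if i \<in> B then space p else A i))"
      using A \<open>finite I\<close> by (subst (1 2) S.emeasure_PiM) auto
    also have "\<dots> = (\<Prod>i\<in>I. emeasure p (A i))"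
      unfolding prod.distrib[symmetric] by (intro prod.cong) (auto simp: emeasure_space_1)
    finally show "emeasure (distr (?P \<Otimes>\<^sub>M ?P) ?P (mix_sample I B)) (Pi\<^sub>E I A)
        = (\<Prod>i\<in>I. emeasure p (A i))" .
  qed simp
qed

lemma nn_integral_mix_sample:
  assumes "prob_space p" "finite I" "f \<in> borel_measurable (\<Pi>\<^sub>M i\<in>I. p)"
  shows "(\<integral>\<^sup>+ u. f (mix_sample I B u) \<partial>((\<Pi>\<^sub>M i\<in>I. p) \<Otimes>\<^sub>M (\<Pi>\<^sub>M i\<in>I. p)))
    = (\<integral>\<^sup>+ z. f z \<partial>(\<Pi>\<^sub>M i\<in>I. p))"
proof -
  let ?P = "\<Pi>\<^sub>M i\<in>I. p"
  have "(\<integral>\<^sup>+ z. f z \<partial>?P) = (\<integral>\<^sup>+ z. f z \<partial>distr (?P \<Otimes>\<^sub>M ?P) ?P (mix_sample I B))"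
    by (simp only: distr_mix_sample[OF assms(1,2)])
  also have "\<dots> = (\<integral>\<^sup>+ u. f (mix_sample I B u) \<partial>(?P \<Otimes>\<^sub>M ?P))"
    using assms(3) by (intro nn_integral_distr) auto
  finally show ?thesis by simp
qed

lemma integral_PiM_component:
  fixes f :: "'z \<Rightarrow> real"
  assumes "prob_space p" "integrable p f" "i \<in> I"
  shows "integrable (\<Pi>\<^sub>M i\<in>I. p) (\<lambda>z. f (z i))"
    and "(\<integral>z. f (z i) \<partial>(\<Pi>\<^sub>M i\<in>I. p)) = (\<integral>x. f x \<partial>p)"
proof -
  interpret product_prob_space "\<lambda>_. p" I
    using assms(1) by (simp add: product_prob_space_def product_prob_space_axioms_def
        product_sigma_finite_def prob_space_imp_sigma_finite)
  have d: "distr (\<Pi>\<^sub>M i\<in>I. p) p (\<lambda>z. z i) = p"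
    using PiM_component[OF assms(3)] by simp
  have m: "(\<lambda>z. z i) \<in> (\<Pi>\<^sub>M i\<in>I. p) \<rightarrow>\<^sub>M p"
    using assms(3) by simp
  show "integrable (\<Pi>\<^sub>M i\<in>I. p) (\<lambda>z. f (z i))"
    using integrable_distr[OF m, of f] assms(2) by (simp add: d)
  show "(\<integral>z. f (z i) \<partial>(\<Pi>\<^sub>M i\<in>I. p)) = (\<integral>x. f x \<partial>p)"
    using integral_distr[OF m, of f] assms(2) by (simp add: d)
qed

text \<open>This is what allows the risk to be replaced by an average over the ghost sample. The
  bound on \<open>n\<close> excludes the default value \<open>1 / real 0 = 0\<close>.\<close>

lemma integral_empirical_risk:
  assumes "prob_space p" "integrable p (\<lambda>z. l z w)" "n \<ge> 1"
  shows "integrable (\<Pi>\<^sub>M i\<in>{1..n}. p) (\<lambda>z. empirical_risk l n z w)"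
    and "(\<integral>z. empirical_risk l n z w \<partial>(\<Pi>\<^sub>M i\<in>{1..n}. p)) = risk p l w"
proof -
  note c = integral_PiM_component[OF assms(1,2), where I = "{1..n}"]
  show "integrable (\<Pi>\<^sub>M i\<in>{1..n}. p) (\<lambda>z. empirical_risk l n z w)"
    unfolding empirical_risk_def using c(1) by (intro integrable_mult_right integrable_sum) auto
  show "(\<integral>z. empirical_risk l n z w \<partial>(\<Pi>\<^sub>M i\<in>{1..n}. p)) = risk p l w"
    unfolding empirical_risk_def risk_def using assms(3) c
    by (simp add: Bochner_Integration.integral_sum)
qed

lemma empirical_risk_diff_le_rademacher_sup:
  fixes e :: "nat \<Rightarrow> real"
  assumes e: "\<And>i. i \<in> {1..n} \<Longrightarrow> e i \<in> {-1, 1}" and "w \<in> W"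
  defines "B \<equiv> {i. e i = 1}"
  shows "ennreal \<bar>empirical_risk l n z' w - empirical_risk l n z w\<bar>
    \<le> rademacher_sup l W n e (mix_sample {1..n} B (z, z'))
      + rademacher_sup l W n e (mix_sample {1..n} (- B) (z, z'))"
proof -
  let ?r = "\<lambda>C. (1 / real n) * (\<Sum>i=1..n. e i * l (mix_sample {1..n} C (z, z') i) w)"
  \<comment> \<open>The identity holds term by term: if \<open>e i = 1\<close>, the mixtures for
    \<open>B\<close> and \<open>- B\<close> take \<open>z i\<close> and \<open>z' i\<close>; if
    \<open>e i = -1\<close>, they take them in the opposite order and the sign compensates.\<close>
  have "(\<Sum>i=1..n. l (z i) w) - (\<Sum>i=1..n. l (z' i) w)
      = (\<Sum>i=1..n. e i * l (mix_sample {1..n} B (z, z') i) w)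
        - (\<Sum>i=1..n. e i * l (mix_sample {1..n} (- B) (z, z') i) w)"
    unfolding sum_subtractf[symmetric]
    by (rule sum.cong) (use e in \<open>force simp: mix_sample_def B_def\<close>)+
  then have "empirical_risk l n z w - empirical_risk l n z' w = ?r B - ?r (- B)"
    unfolding empirical_risk_def by (simp only: right_diff_distrib[symmetric])
  then have "\<bar>empirical_risk l n z' w - empirical_risk l n z w\<bar> \<le> \<bar>?r B\<bar> + \<bar>?r (- B)\<bar>"
    by linarith
  then have "ennreal \<bar>empirical_risk l n z' w - empirical_risk l n z w\<bar>
      \<le> ennreal \<bar>?r B\<bar> + ennreal \<bar>?r (- B)\<bar>"
    \<comment> \<open>As a simp rule, \<open>ennreal_plus\<close> would undo the folding that
      reduces the claim to the real inequality.\<close>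
    by (subst ennreal_plus[symmetric]) (auto intro!: ennreal_leI simp del: ennreal_plus)
  also have "\<dots> \<le> rademacher_sup l W n e (mix_sample {1..n} B (z, z'))
      + rademacher_sup l W n e (mix_sample {1..n} (- B) (z, z'))"
    unfolding rademacher_sup_def using \<open>w \<in> W\<close> by (intro add_mono SUP_upper)
  finally show ?thesis .
qed

text \<open>Fixing the signs makes the exchange set \<open>B\<close> constant, so each mixture is a
  single measurable map of the two samples whose law is known.\<close>

lemma expected_error_le_fixed_signs:
  fixes e :: "nat \<Rightarrow> real"
  assumes p: "prob_space p" and "n \<ge> 1"
    and int: "\<And>w. w \<in> W \<Longrightarrow> integrable p (\<lambda>z. l z w)"
    and e: "\<And>i. i \<in> {1..n} \<Longrightarrow> e i \<in> {-1, 1}"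
    and R [measurable]: "rademacher_sup l W n e \<in> borel_measurable (\<Pi>\<^sub>M i\<in>{1..n}. p)"
  shows "(\<integral>\<^sup>+ z. worst_case_gen_error p l W n z \<partial>(\<Pi>\<^sub>M i\<in>{1..n}. p))
    \<le> 2 * (\<integral>\<^sup>+ z. rademacher_sup l W n e z \<partial>(\<Pi>\<^sub>M i\<in>{1..n}. p))"
proof -
  let ?P = "\<Pi>\<^sub>M i\<in>{1..n}. p"
  interpret P: prob_space ?P by (rule prob_space_PiM) (rule p)
  define B where "B = {i. e i = 1}"
  define F where "F C u = rademacher_sup l W n e (mix_sample {1..n} C u)" for C u
  have [measurable]: "F C \<in> borel_measurable (?P \<Otimes>\<^sub>M ?P)" for C
    unfolding F_def by measurable
  \<comment> \<open>The right-hand side is free of \<open>w\<close>, so bounding each term of the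
    supremum is enough and no supremum has to be moved through an integral.\<close>
  have "worst_case_gen_error p l W n z \<le> (\<integral>\<^sup>+ z'. F B (z, z') + F (- B) (z, z') \<partial>?P)" for z
    unfolding worst_case_gen_error_def
  proof (rule SUP_least)
    fix w assume w: "w \<in> W"
    note er = integral_empirical_risk[where l = l and w = w, OF p int[OF w] \<open>n \<ge> 1\<close>]
    \<comment> \<open>The second term is constant in \<open>z'\<close> and \<open>?P\<close> has
      mass 1; the absolute value then moves inside the integral.\<close>
    have "risk p l w - empirical_risk l n z w
        = (\<integral>z'. empirical_risk l n z' w - empirical_risk l n z w \<partial>?P)"
      by (simp only: Bochner_Integration.integral_diff[OF er(1) P.integrable_const] er(2)
          lebesgue_integral_const P.prob_space scaleR_one)
    then have "ennreal \<bar>risk p l w - empirical_risk l n z w\<bar>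
        \<le> (\<integral>\<^sup>+ z'. ennreal \<bar>empirical_risk l n z' w - empirical_risk l n z w\<bar> \<partial>?P)"
      using integral_norm_bound_ennreal[OF
          Bochner_Integration.integrable_diff[OF er(1) P.integrable_const]]
      by (simp only: real_norm_def)
    also have "\<dots> \<le> (\<integral>\<^sup>+ z'. F B (z, z') + F (- B) (z, z') \<partial>?P)"
      unfolding F_def B_def
      by (intro nn_integral_mono empirical_risk_diff_le_rademacher_sup e w)
    finally show "ennreal \<bar>risk p l w - empirical_risk l n z w\<bar> \<le> \<dots>" .
  qed
  then have "(\<integral>\<^sup>+ z. worst_case_gen_error p l W n z \<partial>?P)
      \<le> (\<integral>\<^sup>+ z. \<integral>\<^sup>+ z'. F B (z, z') + F (- B) (z, z') \<partial>?P \<partial>?P)"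
    by (rule nn_integral_mono)
  also have "\<dots> = (\<integral>\<^sup>+ u. F B u + F (- B) u \<partial>(?P \<Otimes>\<^sub>M ?P))"
    by (rule P.nn_integral_fst) measurable
  also have "\<dots> = (\<integral>\<^sup>+ u. F B u \<partial>(?P \<Otimes>\<^sub>M ?P)) + (\<integral>\<^sup>+ u. F (- B) u \<partial>(?P \<Otimes>\<^sub>M ?P))"
    by (rule nn_integral_add) measurable
  \<comment> \<open>Both mixtures have law \<open>?P\<close>, so the two integrals coincide; this is
    the origin of the factor 2.\<close>
  also have "\<dots> = 2 * (\<integral>\<^sup>+ z. rademacher_sup l W n e z \<partial>?P)"
    unfolding F_def by (simp only: nn_integral_mix_sample[OF p finite_atLeastAtMost R] mult_2)
  finally show ?thesis .
qed

text \<open>The sign measure lives on all real-valued families, so its coordinates are signs only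
  almost surely.\<close>

lemma AE_PiM_signs:
  assumes "finite I"
  shows "AE e in (\<Pi>\<^sub>M i\<in>I. measure_pmf (pmf_of_set {-1, 1 :: real})). \<forall>i\<in>I. e i \<in> {-1, 1}"
proof (rule AE_finite_allI[OF assms])
  fix i assume "i \<in> I"
  then show "AE e in (\<Pi>\<^sub>M i\<in>I. measure_pmf (pmf_of_set {-1, 1 :: real})). e i \<in> {-1, 1}"
    by (intro AE_PiM_component prob_space_measure_pmf) (auto simp: AE_measure_pmf_iff)
qed

theorem theorem0p3:
  fixes M :: "'a measure"
    and p :: "'z measure"
    and Z :: "nat \<Rightarrow> 'a \<Rightarrow> 'z"
    and W :: "'w set"
    and l :: "'z \<Rightarrow> 'w \<Rightarrow> real"
    and n :: nat
    and \<sigma> :: real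
  assumes "prob_space M"
    and "prob_space p"
    and "n \<ge> 1"
    and "W \<noteq> {}"
    and "\<And>z w. z \<in> space p \<Longrightarrow> w \<in> W \<Longrightarrow> l z w \<ge> 0"
    and "prob_space.indep_vars M (\<lambda>_. p) Z {1..n}"
    and "\<And>i. i \<in> {1..n} \<Longrightarrow> distr M p (Z i) = p"
    and "\<sigma> > 0"
    and "\<And>w. w \<in> W \<Longrightarrow> subgaussian p (\<lambda>z. l z w) (\<sigma>\<^sup>2)"
    and "worst_case_gen_error p l W n \<in> borel_measurable (\<Pi>\<^sub>M i\<in>{1..n}. p)"
    and "(\<lambda>(e, z). rademacher_sup l W n e z) \<in> borel_measurable (sign_sample_measure p n)"
  shows "(\<integral>\<^sup>+ \<omega>. worst_case_gen_error p l W n (\<lambda>i. Z i \<omega>) \<partial>M)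
           \<le> 2 * rademacher_complexity p l W n"
proof -
  interpret M: prob_space M by fact
  let ?P = "\<Pi>\<^sub>M i\<in>{1..n}. p"
  let ?E = "\<Pi>\<^sub>M i\<in>{1..n}. measure_pmf (pmf_of_set {-1, 1 :: real})"
  interpret P: prob_space ?P by (rule prob_space_PiM) (rule assms(2))
  interpret E: prob_space ?E by (rule prob_space_PiM) (rule prob_space_measure_pmf)
  \<comment> \<open>Points of \<open>?P\<close> are undefined outside \<open>{1..n}\<close>, hence
    the restriction; the error depends only on the entries kept.\<close>
  let ?S = "\<lambda>\<omega>. \<lambda>i\<in>{1..n}. Z i \<omega>"
  have rv: "Z i \<in> M \<rightarrow>\<^sub>M p" if "i \<in> {1..n}" for i
    using assms(6) that by (simp add: M.indep_vars_def)
  \<comment> \<open>Independence is turned into equality of the joint law with the product law;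
    \<open>n \<ge> 1\<close> makes the index set nonempty.\<close>
  have "distr M ?P ?S = (\<Pi>\<^sub>M i\<in>{1..n}. distr M p (Z i))"
    using assms(3,6) rv by (subst (asm) M.indep_vars_iff_distr_eq_PiM') auto
  also have "\<dots> = ?P"
    by (rule PiM_cong) (simp_all add: assms(7))
  finally have law: "distr M ?P ?S = ?P" .
  have R: "rademacher_sup l W n e \<in> borel_measurable ?P" if "e \<in> space ?E" for e
    using measurable_compose[OF measurable_Pair1'[OF that] assms(11)[unfolded sign_sample_measure_def]]
    by simp
  have "(\<integral>\<^sup>+ \<omega>. worst_case_gen_error p l W n (\<lambda>i. Z i \<omega>) \<partial>M)
      = (\<integral>\<^sup>+ \<omega>. worst_case_gen_error p l W n (?S \<omega>) \<partial>M)"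
    by (simp add: worst_case_gen_error_def empirical_risk_def)
  also have "\<dots> = (\<integral>\<^sup>+ z. worst_case_gen_error p l W n z \<partial>distr M ?P ?S)"
    using rv assms(10) by (subst nn_integral_distr) (auto intro!: measurable_restrict)
  \<comment> \<open>A constant is averaged over the signs, so that the bound for fixed signs applies
    under the outer integral.\<close>
  also have "\<dots> = (\<integral>\<^sup>+ e. (\<integral>\<^sup>+ z. worst_case_gen_error p l W n z \<partial>?P) \<partial>?E)"
    by (simp only: law nn_integral_const E.emeasure_space_1 mult_1_right)
  also have "\<dots> \<le> (\<integral>\<^sup>+ e. 2 * (\<integral>\<^sup>+ z. rademacher_sup l W n e z \<partial>?P) \<partial>?E)"
  proof (rule nn_integral_mono_AE)
    show "AE e in ?E. (\<integral>\<^sup>+ z. worst_case_gen_error p l W n z \<partial>?P)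
        \<le> 2 * (\<integral>\<^sup>+ z. rademacher_sup l W n e z \<partial>?P)"
      \<comment> \<open>\<open>AE_space\<close> supplies \<open>e \<in> space ?E\<close>, on which
        the section measurability \<open>R\<close> depends.\<close>
      using AE_PiM_signs[OF finite_atLeastAtMost] AE_space
    proof eventually_elim
      case (elim e)
      show ?case
        using assms(9) elim
        by (intro expected_error_le_fixed_signs assms(2,3) R) (auto simp: subgaussian_def)
    qed
  qed
  also have "\<dots> = 2 * (\<integral>\<^sup>+ e. (\<integral>\<^sup>+ z. rademacher_sup l W n e z \<partial>?P) \<partial>?E)"
    using P.borel_measurable_nn_integral_fst[OF assms(11)[unfolded sign_sample_measure_def]]
    by (intro nn_integral_cmult) simp
  also have "(\<integral>\<^sup>+ e. (\<integral>\<^sup>+ z. rademacher_sup l W n e z \<partial>?P) \<partial>?E) = rademacher_complexity p l W n"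
    using P.nn_integral_fst[OF assms(11)[unfolded sign_sample_measure_def]]
    by (simp add: rademacher_complexity_def sign_sample_measure_def)
  finally show ?thesis .
qed

end
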